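(* There are infinitely many distinct closed classes $\mathcal{J}$ of colimits which are intermediate between the class of pseudo-filtered colimits and the class of all small colimits, i.e. such that every pseudo-filtered small category belongs to $\mathcal{J}$ and $\mathcal{J}$ is contained in the class of all small categories. Moreover, for each finite simple group $G$, the closed class $\{G\}^r$ of colimits which commute with limits over $G$ in $\mathbf{Set}$ contains every group $H$ that does not have $G$ as a subquotient (up to isomorphism), but does not contain $G$ itself.
   Context: For small categories $\mathbb{I}$ and $\mathbb{J}$, limits over $\mathbb{I}$ commute with colimits over $\mathbb{J}$ in $\mathbf{Set}$ if, for every functor $F:\mathbb{I}\times\mathbb{J}\to\mathbf{Set}$, the canonical map $\operatorname{colim}_{j\in\mathbb{J}}\lim_{i\in\mathbb{I}}F(i,j)\to\lim_{i\in\mathbb{I}}\operatorname{colim}_{j\in\mathbb{J}}F(i,j)$ is a bijection. For a class $\mathcal{I}$ of small categories (regarded as limit-shapes), let $\mathcal{I}^r$ be the class of small categories $\mathbb{J}$ such that colimits over $\mathbb{J}$ commute with limits over $\mathbb{I}$ in $\mathbf{Set}$ for all $\mathbb{I}\in\mathcal{I}$. For a class $\mathcal{J}$ of small categories (regarded as colimit-shapes), let $\mathcal{J}^l$ be the class of small categories $\mathbb{I}$ such that colimits over $\mathbb{J}$ commute with limits over $\mathbb{I}$ in $\mathbf{Set}$ for all $\mathbb{J}\in\mathcal{J}$. A class $\mathcal{J}$ is a closed class of colimits if $\mathcal{J}=(\mathcal{J}^l)^r$. A category is pseudo-filtered if each of its connected components is a filtered category. A group is considered as a category with one object, whose morphisms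 are the elements of the group and whose composition is the group multiplication. A subquotient of a group $H$ is a group of the form $K/L$ with $K$ a subgroup of $H$ and $L$ a normal subgroup of $K$. Simple groups are nontrivial by definition. *)

theory Defs
  imports "HOL-Algebra.SimpleGroups" "HOL-Library.Countable_Set"
begin

text \<open>
  A notion of smallness on an infinite type \<open>'u\<close>: the closure properties of being a set rather
  than a class (equivalently, of belonging to a Grothendieck universe) that make sense for
  subcollections of \<open>'u\<close>. Taking for \<open>'u\<close> a type of ZF sets and for \<open>small\<close> the collections
  that form a set gives the usual meaning of small category and of the category of sets.
  No powerset or infinity axiom is imposed, so the predicate is inhabited over every infinite type;
  this only admits further notions of smallness. Limits and colimits of small sets are formed below
  in larger types, so nothing depends on their being representable in \<open>'u\<close>.
\<close>

definition smallness :: "('u set \<Rightarrow> bool) \<Rightarrow> bool" where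
  "smallness small \<longleftrightarrow>
     infinite (UNIV :: 'u set) \<and>
     (\<forall>A. finite A \<longrightarrow> small A) \<and>
     (\<forall>A B. small A \<and> B \<subseteq> A \<longrightarrow> small B) \<and>
     (\<forall>A f. small A \<longrightarrow> small (f ` A)) \<and>
     (\<forall>A f. small A \<and> (\<forall>a\<in>A. small (f a)) \<longrightarrow> small (\<Union>a\<in>A. f a))"

lemma smallness_all: "infinite (UNIV :: 'u set) \<Longrightarrow> smallness (\<lambda>_ :: 'u set. True)"
  by (simp add: smallness_def)

lemma smallness_countable: "infinite (UNIV :: 'u set) \<Longrightarrow> smallness (countable :: 'u set \<Rightarrow> bool)"
  by (auto simp: smallness_def countable_finite intro: countable_subset)


subsection \<open>Categories\<close>

text \<open>\<open>Comp C g f\<close> is the composite of \<open>f\<close> followed by \<open>g\<close>.\<close>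

record ('o, 'm) cat =
  Obj :: "'o set"
  Arr :: "'m set"
  Dom :: "'m \<Rightarrow> 'o"
  Cod :: "'m \<Rightarrow> 'o"
  Ident :: "'o \<Rightarrow> 'm"
  Comp :: "'m \<Rightarrow> 'm \<Rightarrow> 'm"

definition homset :: "('o, 'm) cat \<Rightarrow> 'o \<Rightarrow> 'o \<Rightarrow> 'm set" where
  "homset C a b = {f \<in> Arr C. Dom C f = a \<and> Cod C f = b}"

definition category :: "('o, 'm) cat \<Rightarrow> bool" where
  "category C \<longleftrightarrow>
     (\<forall>f\<in>Arr C. Dom C f \<in> Obj C \<and> Cod C f \<in> Obj C) \<and>
     (\<forall>a\<in>Obj C. Ident C a \<in> homset C a a) \<and>
     (\<forall>f\<in>Arr C. \<forall>g\<in>Arr C. Dom C g = Cod C f \<longrightarrow> Comp C g f \<in> homset C (Dom C f) (Cod C g)) \<and>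
     (\<forall>f\<in>Arr C. Comp C f (Ident C (Dom C f)) = f \<and> Comp C (Ident C (Cod C f)) f = f) \<and>
     (\<forall>f\<in>Arr C. \<forall>g\<in>Arr C. \<forall>h\<in>Arr C. Dom C g = Cod C f \<and> Dom C h = Cod C g \<longrightarrow>
        Comp C h (Comp C g f) = Comp C (Comp C h g) f)"

definition small_cats :: "('u set \<Rightarrow> bool) \<Rightarrow> ('u, 'u) cat set" where
  "small_cats small = {C. category C \<and> small (Obj C) \<and> small (Arr C)}"

definition prod_cat :: "('o, 'm) cat \<Rightarrow> ('p, 'n) cat \<Rightarrow> ('o \<times> 'p, 'm \<times> 'n) cat" where
  "prod_cat C D =
     \<lparr>Obj = Obj C \<times> Obj D,
      Arr = Arr C \<times> Arr D,
      Dom = (\<lambda>(f, g). (Dom C f, Dom D g)),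
      Cod = (\<lambda>(f, g). (Cod C f, Cod D g)),
      Ident = (\<lambda>(a, b). (Ident C a, Ident D b)),
      Comp = (\<lambda>(f', g') (f, g). (Comp C f' f, Comp D g' g))\<rparr>"

definition full_subcat :: "('o, 'm) cat \<Rightarrow> 'o set \<Rightarrow> ('o, 'm) cat" where
  "full_subcat C A = C\<lparr>Obj := A, Arr := {f \<in> Arr C. Dom C f \<in> A \<and> Cod C f \<in> A}\<rparr>"

definition filtered :: "('o, 'm) cat \<Rightarrow> bool" where
  "filtered C \<longleftrightarrow>
     category C \<and> Obj C \<noteq> {} \<and>
     (\<forall>a\<in>Obj C. \<forall>b\<in>Obj C. \<exists>c\<in>Obj C. homset C a c \<noteq> {} \<and> homset C b c \<noteq> {}) \<and>
     (\<forall>a\<in>Obj C. \<forall>b\<in>Obj C. \<forall>f\<in>homset C a b. \<forall>g\<in>homset C a b.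
        \<exists>c\<in>Obj C. \<exists>h\<in>homset C b c. Comp C h f = Comp C h g)"

text \<open>The equivalence relation on a set \<open>S\<close> generated by \<open>r \<subseteq> S \<times> S\<close>.\<close>

definition generated_equiv :: "'a set \<Rightarrow> ('a \<times> 'a) set \<Rightarrow> ('a \<times> 'a) set" where
  "generated_equiv S r = (r \<union> r\<inverse>)\<^sup>* \<inter> S \<times> S"

definition connected_components :: "('o, 'm) cat \<Rightarrow> 'o set set" where
  "connected_components C = Obj C // generated_equiv (Obj C) ((\<lambda>f. (Dom C f, Cod C f)) ` Arr C)"

definition pseudo_filtered :: "('o, 'm) cat \<Rightarrow> bool" where
  "pseudo_filtered C \<longleftrightarrow>
     category C \<and> (\<forall>A\<in>connected_components C. filtered (full_subcat C A))"

text \<open>The single object of a group as a category is (arbitrarily) taken to be the neutral element.\<close>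

definition group_cat :: "'a monoid \<Rightarrow> ('a, 'a) cat" where
  "group_cat G =
     \<lparr>Obj = {\<one>\<^bsub>G\<^esub>},
      Arr = carrier G,
      Dom = (\<lambda>_. \<one>\<^bsub>G\<^esub>),
      Cod = (\<lambda>_. \<one>\<^bsub>G\<^esub>),
      Ident = (\<lambda>_. \<one>\<^bsub>G\<^esub>),
      Comp = (\<lambda>g f. g \<otimes>\<^bsub>G\<^esub> f)\<rparr>"

definition is_subquotient :: "'a monoid \<Rightarrow> 'b monoid \<Rightarrow> bool" where
  "is_subquotient G H \<longleftrightarrow>
     (\<exists>K L. subgroup K H \<and> L \<lhd> H\<lparr>carrier := K\<rparr> \<and> G \<cong> (H\<lparr>carrier := K\<rparr> Mod L))"


subsection \<open>Set-valued functors, their limits and colimits\<close>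

record ('o, 'm, 'x) set_fun =
  FObj :: "'o \<Rightarrow> 'x set"
  FArr :: "'m \<Rightarrow> 'x \<Rightarrow> 'x"

definition set_functor :: "('o, 'm) cat \<Rightarrow> ('o, 'm, 'x) set_fun \<Rightarrow> bool" where
  "set_functor C X \<longleftrightarrow>
     (\<forall>f\<in>Arr C. \<forall>x\<in>FObj X (Dom C f). FArr X f x \<in> FObj X (Cod C f)) \<and>
     (\<forall>a\<in>Obj C. \<forall>x\<in>FObj X a. FArr X (Ident C a) x = x) \<and>
     (\<forall>f\<in>Arr C. \<forall>g\<in>Arr C. Dom C g = Cod C f \<longrightarrow>
        (\<forall>x\<in>FObj X (Dom C f). FArr X (Comp C g f) x = FArr X g (FArr X f x)))"

text \<open>The limit: compatible families.\<close>

definition set_lim :: "('o, 'm) cat \<Rightarrow> ('o, 'm, 'x) set_fun \<Rightarrow> ('o \<Rightarrow> 'x) set" where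
  "set_lim C X =
     {s \<in> Pi\<^sub>E (Obj C) (FObj X). \<forall>f\<in>Arr C. FArr X f (s (Dom C f)) = s (Cod C f)}"

definition set_lim_map :: "('o, 'm) cat \<Rightarrow> ('o \<Rightarrow> 'x \<Rightarrow> 'y) \<Rightarrow> ('o \<Rightarrow> 'x) \<Rightarrow> ('o \<Rightarrow> 'y)" where
  "set_lim_map C \<eta> s = (\<lambda>a\<in>Obj C. \<eta> a (s a))"

text \<open>
  The colimit: the disjoint union modulo the equivalence relation generated by
  \<open>(a, x) \<sim> (b, X f x)\<close> for \<open>f : a \<rightarrow> b\<close>.
\<close>

definition colim_rel ::
    "('o, 'm) cat \<Rightarrow> ('o, 'm, 'x) set_fun \<Rightarrow> (('o \<times> 'x) \<times> ('o \<times> 'x)) set" where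
  "colim_rel C X =
     generated_equiv (Sigma (Obj C) (FObj X))
       {((Dom C f, x), (Cod C f, FArr X f x)) | f x. f \<in> Arr C \<and> x \<in> FObj X (Dom C f)}"

definition set_colim :: "('o, 'm) cat \<Rightarrow> ('o, 'm, 'x) set_fun \<Rightarrow> ('o \<times> 'x) set set" where
  "set_colim C X = Sigma (Obj C) (FObj X) // colim_rel C X"

definition colim_in :: "('o, 'm) cat \<Rightarrow> ('o, 'm, 'x) set_fun \<Rightarrow> 'o \<Rightarrow> 'x \<Rightarrow> ('o \<times> 'x) set" where
  "colim_in C X a x = colim_rel C X `` {(a, x)}"

text \<open>
  The map out of the colimit that sends the class of \<open>(a, x)\<close> to \<open>\<phi> a x\<close>, for a cocone \<open>\<phi>\<close>
  (which is then constant on each class).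
\<close>

definition colim_desc :: "('o \<Rightarrow> 'x \<Rightarrow> 'y) \<Rightarrow> ('o \<times> 'x) set \<Rightarrow> 'y" where
  "colim_desc \<phi> c = the_elem ((\<lambda>(a, x). \<phi> a x) ` c)"


subsection \<open>Commutation of limits and colimits\<close>

definition fix_left :: "('o, 'm) cat \<Rightarrow> ('o \<times> 'p, 'm \<times> 'n, 'x) set_fun \<Rightarrow> 'o \<Rightarrow> ('p, 'n, 'x) set_fun"
  where "fix_left I F i =
    \<lparr>FObj = (\<lambda>j. FObj F (i, j)), FArr = (\<lambda>g. FArr F (Ident I i, g))\<rparr>"

definition fix_right :: "('p, 'n) cat \<Rightarrow> ('o \<times> 'p, 'm \<times> 'n, 'x) set_fun \<Rightarrow> 'p \<Rightarrow> ('o, 'm, 'x) set_fun"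
  where "fix_right J F j =
    \<lparr>FObj = (\<lambda>i. FObj F (i, j)), FArr = (\<lambda>f. FArr F (f, Ident J j))\<rparr>"

text \<open>The functor \<open>j \<mapsto> lim\<^sub>i F(i,j)\<close> on \<open>J\<close>.\<close>

definition lim_fun :: "('o, 'm) cat \<Rightarrow> ('p, 'n) cat \<Rightarrow> ('o \<times> 'p, 'm \<times> 'n, 'x) set_fun
    \<Rightarrow> ('p, 'n, 'o \<Rightarrow> 'x) set_fun" where
  "lim_fun I J F =
     \<lparr>FObj = (\<lambda>j. set_lim I (fix_right J F j)),
      FArr = (\<lambda>g. set_lim_map I (\<lambda>i. FArr F (Ident I i, g)))\<rparr>"

text \<open>The functor \<open>i \<mapsto> colim\<^sub>j F(i,j)\<close> on \<open>I\<close>.\<close>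

definition colim_fun :: "('o, 'm) cat \<Rightarrow> ('p, 'n) cat \<Rightarrow> ('o \<times> 'p, 'm \<times> 'n, 'x) set_fun
    \<Rightarrow> ('o, 'm, ('p \<times> 'x) set) set_fun" where
  "colim_fun I J F =
     \<lparr>FObj = (\<lambda>i. set_colim J (fix_left I F i)),
      FArr = (\<lambda>f. colim_desc
                (\<lambda>j x. colim_in J (fix_left I F (Cod I f)) j (FArr F (f, Ident J j) x)))\<rparr>"

text \<open>
  The canonical map \<open>colim\<^sub>j lim\<^sub>i F(i,j) \<rightarrow> lim\<^sub>i colim\<^sub>j F(i,j)\<close>,
  sending \<open>[(j, (s\<^sub>i)\<^sub>i)]\<close> to \<open>([(j, s\<^sub>i)])\<^sub>i\<close>.
\<close>

definition canonical_map :: "('o, 'm) cat \<Rightarrow> ('p, 'n) cat \<Rightarrow> ('o \<times> 'p, 'm \<times> 'n, 'x) set_fun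
    \<Rightarrow> ('p \<times> ('o \<Rightarrow> 'x)) set \<Rightarrow> ('o \<Rightarrow> ('p \<times> 'x) set)" where
  "canonical_map I J F =
     colim_desc (\<lambda>j s. set_lim_map I (\<lambda>i. colim_in J (fix_left I F i) j) s)"

text \<open>Limits over \<open>I\<close> commute with colimits over \<open>J\<close> in the category of small sets.\<close>

definition commutes :: "('u set \<Rightarrow> bool) \<Rightarrow> ('u, 'u) cat \<Rightarrow> ('u, 'u) cat \<Rightarrow> bool" where
  "commutes small I J \<longleftrightarrow>
     (\<forall>F :: ('u \<times> 'u, 'u \<times> 'u, 'u) set_fun.
        set_functor (prod_cat I J) F \<and> (\<forall>a\<in>Obj (prod_cat I J). small (FObj F a)) \<longrightarrow>
        bij_betw (canonical_map I J F)
          (set_colim J (lim_fun I J F)) (set_lim I (colim_fun I J F)))"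

definition commuting_colims ::
    "('u set \<Rightarrow> bool) \<Rightarrow> ('u, 'u) cat set \<Rightarrow> ('u, 'u) cat set" where
  "commuting_colims small \<I> = {J \<in> small_cats small. \<forall>I\<in>\<I>. commutes small I J}"

definition commuting_lims ::
    "('u set \<Rightarrow> bool) \<Rightarrow> ('u, 'u) cat set \<Rightarrow> ('u, 'u) cat set" where
  "commuting_lims small \<J> = {I \<in> small_cats small. \<forall>J\<in>\<J>. commutes small I J}"

definition closed_class :: "('u set \<Rightarrow> bool) \<Rightarrow> ('u, 'u) cat set \<Rightarrow> bool" where
  "closed_class small \<J> \<longleftrightarrow> \<J> = commuting_colims small (commuting_lims small \<J>)"

end

theory Submission
  imports Defs "HOL-Algebra.Elementary_Groups" "HOL-Algebra.Weak_Morphisms"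
begin

text \<open>
  For a group \<open>G\<close> and a functor \<open>F : G \<times> J \<rightarrow> Set\<close>, limits over \<open>G\<close> are sets of fixed points.
  If spans in \<open>J\<close> can be completed to commutative squares (as in groups and in pseudo-filtered
  categories), then two elements agree in a colimit over \<open>J\<close> exactly when they become equal along a
  cospan. This makes the canonical map injective, and reduces surjectivity to moving an element
  whose class is fixed by \<open>G\<close> to an element which is itself fixed. For finite \<open>G\<close> and
  pseudo-filtered \<open>J\<close>, one coequalizes finitely many pairs of arrows. For \<open>J\<close> a group \<open>H\<close>, the
  stabilizer of such an element \<open>x\<close> in \<open>G \<times> H\<close> projects onto \<open>G\<close>; by Goursat's lemma and simplicity
  of \<open>G\<close>, either \<open>G\<close> fixes \<open>x\<close> or the stabilizer is the graph of a homomorphism from a subgroup of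
  \<open>H\<close> onto \<open>G\<close>. Conversely, \<open>G\<close> acting on itself from both sides shows that \<open>G\<close> does not commute
  with \<open>G\<close>. The cyclic groups of prime order thus yield infinitely many closed classes.
\<close>

section \<open>Colimits of sets\<close>

lemma equiv_generated_equiv: "equiv S (generated_equiv S r)"
proof (rule equivI)
  show "sym (generated_equiv S r)"
    unfolding generated_equiv_def
    by (intro sym_Int sym_rtrancl sym_Un_converse) (auto simp: sym_def)
  show "trans (generated_equiv S r)"
    unfolding generated_equiv_def
    by (intro trans_Int trans_rtrancl) (auto simp: trans_def)
qed (auto simp: generated_equiv_def refl_on_def)

text \<open>A zigzag of \<open>r\<close>-steps starting in \<open>S\<close> never leaves
  \<open>E\<close>, by induction on its length. This minimality is the tool for bounding
  \<open>colim_rel\<close> from above by an explicit relation.\<close>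

lemma generated_equiv_subset:
  assumes "equiv S E" "r \<subseteq> E"
  shows "generated_equiv S r \<subseteq> E"
proof -
  have "(x, y) \<in> E" if "(x, y) \<in> (r \<union> r\<inverse>)\<^sup>*" "x \<in> S" for x y
    using that
  proof (induction rule: rtrancl_induct)
    case base
    then show ?case using assms(1) by (auto simp: equiv_def refl_on_def)
  next
    case (step y z)
    then have "(y, z) \<in> E"
      using assms by (auto simp: equiv_def sym_def)
    with step show ?case using assms(1) by (meson equiv_def transD)
  qed
  then show ?thesis by (auto simp: generated_equiv_def)
qed

lemma generated_equivI: "(x, y) \<in> r \<Longrightarrow> x \<in> S \<Longrightarrow> y \<in> S \<Longrightarrow> (x, y) \<in> generated_equiv S r"
  by (auto simp: generated_equiv_def)

section \<open>The axioms of categories and functors as rewrite rules\<close>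

lemma categoryD:
  assumes "category C"
  shows "f \<in> Arr C \<Longrightarrow> Dom C f \<in> Obj C" "f \<in> Arr C \<Longrightarrow> Cod C f \<in> Obj C"
    and "a \<in> Obj C \<Longrightarrow> Ident C a \<in> Arr C" "a \<in> Obj C \<Longrightarrow> Dom C (Ident C a) = a"
      "a \<in> Obj C \<Longrightarrow> Cod C (Ident C a) = a"
    and "f \<in> Arr C \<Longrightarrow> g \<in> Arr C \<Longrightarrow> Dom C g = Cod C f \<Longrightarrow> Comp C g f \<in> Arr C"
      "f \<in> Arr C \<Longrightarrow> g \<in> Arr C \<Longrightarrow> Dom C g = Cod C f \<Longrightarrow> Dom C (Comp C g f) = Dom C f"
      "f \<in> Arr C \<Longrightarrow> g \<in> Arr C \<Longrightarrow> Dom C g = Cod C f \<Longrightarrow> Cod C (Comp C g f) = Cod C g"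
    and "f \<in> Arr C \<Longrightarrow> Comp C f (Ident C (Dom C f)) = f"
      "f \<in> Arr C \<Longrightarrow> Comp C (Ident C (Cod C f)) f = f"
  using assms unfolding category_def homset_def by simp_all

lemma set_functorD:
  assumes "set_functor C X"
  shows "f \<in> Arr C \<Longrightarrow> x \<in> FObj X (Dom C f) \<Longrightarrow> FArr X f x \<in> FObj X (Cod C f)"
    and "a \<in> Obj C \<Longrightarrow> x \<in> FObj X a \<Longrightarrow> FArr X (Ident C a) x = x"
    and "f \<in> Arr C \<Longrightarrow> g \<in> Arr C \<Longrightarrow> Dom C g = Cod C f \<Longrightarrow> x \<in> FObj X (Dom C f)
      \<Longrightarrow> FArr X (Comp C g f) x = FArr X g (FArr X f x)"
  using assms by (auto simp: set_functor_def)

section \<open>Classes in a colimit and maps out of it\<close>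

lemma equiv_colim_rel: "equiv (Sigma (Obj C) (FObj X)) (colim_rel C X)"
  unfolding colim_rel_def by (rule equiv_generated_equiv)

lemma colim_relI:
  assumes "category C" "set_functor C X" "f \<in> Arr C" "x \<in> FObj X (Dom C f)"
  shows "((Dom C f, x), (Cod C f, FArr X f x)) \<in> colim_rel C X"
  unfolding colim_rel_def
  by (rule generated_equivI) (use assms in \<open>auto simp: categoryD set_functorD\<close>)

lemma colim_in_eq_iff:
  assumes "a \<in> Obj C" "x \<in> FObj X a" "b \<in> Obj C" "y \<in> FObj X b"
  shows "colim_in C X a x = colim_in C X b y \<longleftrightarrow> ((a, x), (b, y)) \<in> colim_rel C X"
  unfolding colim_in_def
  by (rule eq_equiv_class_iff[OF equiv_colim_rel]) (use assms in auto)

lemma colim_in_arrow: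
  assumes "category C" "set_functor C X" "f \<in> Arr C" "x \<in> FObj X (Dom C f)"
  shows "colim_in C X (Cod C f) (FArr X f x) = colim_in C X (Dom C f) x"
  using colim_relI[OF assms] assms
  by (metis colim_in_def equiv_class_eq equiv_colim_rel)

lemma set_colim_eq:
  "set_colim C X = {colim_in C X a x | a x. a \<in> Obj C \<and> x \<in> FObj X a}"
  unfolding set_colim_def quotient_def colim_in_def by auto

text \<open>A cocone takes the same value at both ends of each generating step, in either direction,
  hence along every zigzag. Its image of a class is therefore a singleton, on which
  \<open>the_elem\<close> returns the expected value.\<close>

lemma colim_desc_colim_in:
  assumes cocone: "\<And>f x. f \<in> Arr C \<Longrightarrow> x \<in> FObj X (Dom C f) \<Longrightarrow>
      \<phi> (Cod C f) (FArr X f x) = \<phi> (Dom C f) x"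
    and "a \<in> Obj C" "x \<in> FObj X a"
  shows "colim_desc \<phi> (colim_in C X a x) = \<phi> a x"
proof -
  have "case_prod \<phi> q = \<phi> a x" if "q \<in> colim_in C X a x" for q
  proof -
    have "((a, x), q) \<in> ({((Dom C f, x), (Cod C f, FArr X f x)) | f x. f \<in> Arr C \<and> x \<in> FObj X (Dom C f)}
        \<union> {((Dom C f, x), (Cod C f, FArr X f x)) | f x. f \<in> Arr C \<and> x \<in> FObj X (Dom C f)}\<inverse>)\<^sup>*"
      using that by (auto simp: colim_in_def colim_rel_def generated_equiv_def)
    then show ?thesis
      by (induction rule: rtrancl_induct) (auto simp: cocone)
  qed
  moreover have "(a, x) \<in> colim_in C X a x"
    using equiv_class_self[OF equiv_colim_rel] assms(2,3) unfolding colim_in_def by fastforce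
  ultimately have "the_elem (case_prod \<phi> ` colim_in C X a x) = case_prod \<phi> (a, x)"
    by (intro the_elem_image_unique) auto
  then show ?thesis by (simp add: colim_desc_def)
qed

text \<open>An Ore (amalgamation) condition: the common part of being a group and being
  pseudo-filtered that makes \<open>equalized\<close> transitive.\<close>

definition completes_spans :: "('o, 'm) cat \<Rightarrow> bool" where
  "completes_spans C \<longleftrightarrow> (\<forall>f\<in>Arr C. \<forall>g\<in>Arr C. Dom C f = Dom C g \<longrightarrow>
     (\<exists>h\<in>Arr C. \<exists>k\<in>Arr C. Dom C h = Cod C f \<and> Dom C k = Cod C g \<and> Cod C h = Cod C k \<and>
        Comp C h f = Comp C k g))"

definition equalized :: "('o, 'm) cat \<Rightarrow> ('o, 'm, 'x) set_fun \<Rightarrow> 'o \<Rightarrow> 'x \<Rightarrow> 'o \<Rightarrow> 'x \<Rightarrow> bool" where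
  "equalized C X a x b y \<longleftrightarrow> (\<exists>u\<in>Arr C. \<exists>v\<in>Arr C. Dom C u = a \<and> Dom C v = b \<and>
     Cod C u = Cod C v \<and> FArr X u x = FArr X v y)"

text \<open>The legs \<open>v\<close> and \<open>u'\<close> of the two given cospans form a span out
  of the middle object \<open>b\<close>. Completing it to a square glues the two cospans into one
  from \<open>a\<close> and \<open>c\<close>.\<close>

lemma equalized_trans:
  assumes C: "category C" "completes_spans C" and X: "set_functor C X"
    and "x \<in> FObj X a" "y \<in> FObj X b" "z \<in> FObj X c"
    and "equalized C X a x b y" "equalized C X b y c z"
  shows "equalized C X a x c z"
proof -
  obtain u v where uv: "u \<in> Arr C" "v \<in> Arr C" "Dom C u = a" "Dom C v = b"
      "Cod C u = Cod C v" "FArr X u x = FArr X v y"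
    using assms by (auto simp: equalized_def)
  obtain u' v' where uv': "u' \<in> Arr C" "v' \<in> Arr C" "Dom C u' = b" "Dom C v' = c"
      "Cod C u' = Cod C v'" "FArr X u' y = FArr X v' z"
    using assms by (auto simp: equalized_def)
  obtain h k where hk: "h \<in> Arr C" "k \<in> Arr C" "Dom C h = Cod C v" "Dom C k = Cod C u'"
      "Cod C h = Cod C k" "Comp C h v = Comp C k u'"
    using C(2) uv uv' unfolding completes_spans_def by metis
  have "FArr X (Comp C h u) x = FArr X h (FArr X v y)"
    using uv hk assms by (simp add: set_functorD)
  also have "\<dots> = FArr X (Comp C h v) y"
    using uv hk(1,3) assms by (simp add: set_functorD)
  also have "\<dots> = FArr X (Comp C k u') y"
    by (simp add: hk(6))
  also have "\<dots> = FArr X k (FArr X u' y)"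
    using uv' hk assms by (simp add: set_functorD)
  also have "\<dots> = FArr X (Comp C k v') z"
    using uv' hk assms by (simp add: set_functorD)
  finally show ?thesis
    unfolding equalized_def
    using uv uv' hk C(1)
    by (intro bexI[of _ "Comp C h u"] bexI[of _ "Comp C k v'"]) (auto simp: categoryD)
qed

text \<open>Zigzags collapse to single cospans: \<open>equalized\<close> restricts to an equivalence
  relation that contains the generating pairs, so it contains \<open>colim_rel\<close>. Conversely,
  moving along either leg of a cospan does not change the class.\<close>

lemma colim_rel_iff_equalized:
  assumes C: "category C" "completes_spans C" and X: "set_functor C X"
    and "a \<in> Obj C" "x \<in> FObj X a" "b \<in> Obj C" "y \<in> FObj X b"
  shows "((a, x), (b, y)) \<in> colim_rel C X \<longleftrightarrow> equalized C X a x b y"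
proof
  define E where "E = {((a, x), (b, y)) | a x b y. a \<in> Obj C \<and> x \<in> FObj X a \<and> b \<in> Obj C \<and>
    y \<in> FObj X b \<and> equalized C X a x b y}"
  have refl: "equalized C X a x a x" if "a \<in> Obj C" "x \<in> FObj X a" for a x
    unfolding equalized_def using that C
    by (intro bexI[of _ "Ident C a"]) (auto simp: categoryD)
  have sym: "equalized C X b y a x" if "equalized C X a x b y" for a x b y
    using that unfolding equalized_def by metis
  have "equiv (Sigma (Obj C) (FObj X)) E"
  proof (rule equivI)
    show "refl_on (Sigma (Obj C) (FObj X)) E"
      by (auto simp: refl_on_def E_def refl)
    show "sym E" by (auto simp: sym_def E_def intro: sym)
    show "trans E"
      by (auto simp: trans_def E_def intro: equalized_trans[OF C X])
  qed (auto simp: E_def)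
  moreover have "((Dom C f, x), (Cod C f, FArr X f x)) \<in> E"
    if "f \<in> Arr C" "x \<in> FObj X (Dom C f)" for f x
  proof -
    have "equalized C X (Dom C f) x (Cod C f) (FArr X f x)"
      unfolding equalized_def using that C X
      by (intro bexI[of _ f] bexI[of _ "Ident C (Cod C f)"]) (auto simp: categoryD set_functorD)
    then show ?thesis using that C X by (auto simp: E_def categoryD set_functorD)
  qed
  ultimately have "colim_rel C X \<subseteq> E"
    unfolding colim_rel_def by (intro generated_equiv_subset) auto
  then show "((a, x), (b, y)) \<in> colim_rel C X \<Longrightarrow> equalized C X a x b y"
    by (auto simp: E_def)
next
  assume "equalized C X a x b y"
  then obtain u v where uv: "u \<in> Arr C" "v \<in> Arr C" "Dom C u = a" "Dom C v = b"
      "Cod C u = Cod C v" "FArr X u x = FArr X v y"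
    by (auto simp: equalized_def)
  have "colim_in C X a x = colim_in C X b y"
    using colim_in_arrow[OF C(1) X uv(1), of x] colim_in_arrow[OF C(1) X uv(2), of y] uv assms
    by simp
  then show "((a, x), (b, y)) \<in> colim_rel C X"
    using assms colim_in_eq_iff by metis
qed


section \<open>Commutation with limits over a group\<close>

lemma group_cat_simps [simp]:
  "Obj (group_cat G) = {\<one>\<^bsub>G\<^esub>}" "Arr (group_cat G) = carrier G" "Dom (group_cat G) g = \<one>\<^bsub>G\<^esub>"
  "Cod (group_cat G) g = \<one>\<^bsub>G\<^esub>" "Ident (group_cat G) a = \<one>\<^bsub>G\<^esub>"
  "Comp (group_cat G) g h = g \<otimes>\<^bsub>G\<^esub> h"
  by (simp_all add: group_cat_def)

lemma category_group_cat: "group G \<Longrightarrow> category (group_cat G)"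
  using group.is_monoid[of G]
  by (auto simp: category_def homset_def monoid.m_assoc monoid.m_closed)

text \<open>The inverses of the two arrows complete the span, since both composites are then the
  neutral element.\<close>

lemma completes_spans_group_cat:
  assumes "group G"
  shows "completes_spans (group_cat G)"
proof -
  interpret group G by fact
  have "inv\<^bsub>G\<^esub> f \<otimes>\<^bsub>G\<^esub> f = inv\<^bsub>G\<^esub> g \<otimes>\<^bsub>G\<^esub> g" if "f \<in> carrier G" "g \<in> carrier G" for f g
    using that by simp
  then show ?thesis
    unfolding completes_spans_def by (metis group_cat_simps(2-4,6) inv_closed)
qed

text \<open>The common setting of both commutation results and of the counterexample. A functor on
  the product amounts to the functor \<open>X\<close> on \<open>J\<close> together with an action of
  \<open>G\<close> that is natural in \<open>J\<close>; this is the form used from here on.\<close>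

locale group_functor = group G for G (structure) +
  fixes J :: "('p, 'n) cat" and F :: "('a \<times> 'p, 'a \<times> 'n, 'x) set_fun"
  assumes category_J: "category J"
    and functor_F: "set_functor (prod_cat (group_cat G) J) F"
begin

abbreviation X :: "('p, 'n, 'x) set_fun" where
  "X \<equiv> fix_left (group_cat G) F \<one>"

definition act :: "'a \<Rightarrow> 'p \<Rightarrow> 'x \<Rightarrow> 'x" where
  "act g j = FArr F (g, Ident J j)"

definition fixed_points :: "'p \<Rightarrow> 'x set" where
  "fixed_points j = {x \<in> FObj X j. \<forall>g\<in>carrier G. act g j x = x}"

text \<open>As \<open>group_cat\<close> has a single object, a compatible family has a single
  component. \<open>point\<close> turns an element into such a family, undefined outside
  \<open>{\<one>}\<close> as \<open>Pi\<^sub>E\<close> requires.\<close>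

definition point :: "'y \<Rightarrow> 'a \<Rightarrow> 'y" where
  "point x = (\<lambda>_\<in>{\<one>}. x)"

lemma point_one [simp]: "point x \<one> = x"
  by (simp add: point_def)

lemma point_eq_iff [simp]: "point x = point y \<longleftrightarrow> x = y"
  by (metis point_one)

lemma F_closed:
  "g \<in> carrier G \<Longrightarrow> u \<in> Arr J \<Longrightarrow> x \<in> FObj X (Dom J u) \<Longrightarrow> FArr F (g, u) x \<in> FObj X (Cod J u)"
  using set_functorD(1)[OF functor_F, of "(g, u)" x] by (simp add: prod_cat_def fix_left_def)

lemma F_comp:
  "g \<in> carrier G \<Longrightarrow> h \<in> carrier G \<Longrightarrow> u \<in> Arr J \<Longrightarrow> v \<in> Arr J \<Longrightarrow> Dom J v = Cod J u \<Longrightarrow>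
     x \<in> FObj X (Dom J u) \<Longrightarrow> FArr F (h, v) (FArr F (g, u) x) = FArr F (h \<otimes> g, Comp J v u) x"
  using set_functorD(3)[OF functor_F, of "(g, u)" "(h, v)" x] by (simp add: prod_cat_def fix_left_def)

lemma F_ident: "j \<in> Obj J \<Longrightarrow> x \<in> FObj X j \<Longrightarrow> FArr F (\<one>, Ident J j) x = x"
  using set_functorD(2)[OF functor_F, of "(\<one>, j)" x] by (simp add: prod_cat_def fix_left_def)

lemma FArr_X: "FArr X u = FArr F (\<one>, u)"
  by (simp add: fix_left_def)

lemma functor_X: "set_functor J X"
  unfolding set_functor_def FArr_X
  by (auto simp: F_closed F_ident F_comp)

lemma act_closed: "g \<in> carrier G \<Longrightarrow> j \<in> Obj J \<Longrightarrow> x \<in> FObj X j \<Longrightarrow> act g j x \<in> FObj X j"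
  using F_closed[of g "Ident J j" x] category_J by (simp add: act_def categoryD)

text \<open>Both ways around the naturality square compose to the action of the pair
  \<open>(g, u)\<close>.\<close>

lemma act_natural:
  assumes "g \<in> carrier G" "u \<in> Arr J" "x \<in> FObj X (Dom J u)"
  shows "act g (Cod J u) (FArr X u x) = FArr F (g, u) x"
    and "FArr X u (act g (Dom J u) x) = FArr F (g, u) x"
  using assms category_J by (simp_all add: act_def FArr_X F_comp categoryD)

text \<open>By naturality the arrows of \<open>X\<close> commute with \<open>G\<close>, so the fixed
  points form a subfunctor of \<open>X\<close>.\<close>

lemma fixed_points_arrow:
  assumes "u \<in> Arr J" "x \<in> fixed_points (Dom J u)"
  shows "FArr X u x \<in> fixed_points (Cod J u)"
proof -
  have "act g (Cod J u) (FArr X u x) = FArr X u x" if "g \<in> carrier G" for g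
    using act_natural[OF that assms(1), of x] assms that by (simp add: fixed_points_def)
  then show ?thesis
    using assms functor_X by (auto simp: fixed_points_def set_functorD)
qed

lemma set_lim_eq: "j \<in> Obj J \<Longrightarrow> set_lim (group_cat G) (fix_right J F j) = point ` fixed_points j"
proof (intro subset_antisym subsetI)
  fix s assume "s \<in> set_lim (group_cat G) (fix_right J F j)"
  then have "s = point (s \<one>)" "s \<one> \<in> fixed_points j"
    by (auto simp: set_lim_def fix_right_def fixed_points_def fix_left_def act_def point_def
        fun_eq_iff PiE_def extensional_def)
  then show "s \<in> point ` fixed_points j" by blast
qed (auto simp: set_lim_def fix_right_def fixed_points_def fix_left_def act_def point_def
    split: if_splits)

section \<open>The functor of fixed points\<close>

lemma lim_fun_simps:
  "j \<in> Obj J \<Longrightarrow> FObj (lim_fun (group_cat G) J F) j = point ` fixed_points j"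
  "FArr (lim_fun (group_cat G) J F) u (point x) = point (FArr X u x)"
  by (simp_all add: lim_fun_def set_lim_eq set_lim_map_def point_def FArr_X fun_eq_iff)

lemma functor_lim_fun: "set_functor J (lim_fun (group_cat G) J F)"
  unfolding set_functor_def
proof (intro conjI ballI impI)
  fix u s assume u: "u \<in> Arr J" "s \<in> FObj (lim_fun (group_cat G) J F) (Dom J u)"
  then show "FArr (lim_fun (group_cat G) J F) u s \<in> FObj (lim_fun (group_cat G) J F) (Cod J u)"
    using category_J by (auto simp: lim_fun_simps categoryD fixed_points_arrow)
next
  fix j s assume "j \<in> Obj J" "s \<in> FObj (lim_fun (group_cat G) J F) j"
  then show "FArr (lim_fun (group_cat G) J F) (Ident J j) s = s"
    using functor_X by (auto simp: lim_fun_simps set_functorD fixed_points_def)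
next
  fix u v s assume "u \<in> Arr J" "v \<in> Arr J" "Dom J v = Cod J u"
    "s \<in> FObj (lim_fun (group_cat G) J F) (Dom J u)"
  then show "FArr (lim_fun (group_cat G) J F) (Comp J v u) s =
      FArr (lim_fun (group_cat G) J F) v (FArr (lim_fun (group_cat G) J F) u s)"
    using category_J functor_X by (auto simp: lim_fun_simps categoryD set_functorD fixed_points_def)
qed

text \<open>Naturality makes \<open>(j, x) \<mapsto> [(j, act g j x)]\<close> a cocone, so
  \<open>G\<close> acts on the colimit through representatives.\<close>

lemma colim_fun_arrow:
  assumes "g \<in> carrier G" "j \<in> Obj J" "x \<in> FObj X j"
  shows "FArr (colim_fun (group_cat G) J F) g (colim_in J X j x) = colim_in J X j (act g j x)"
proof -
  have "colim_desc (\<lambda>j x. colim_in J X j (act g j x)) (colim_in J X j x) = colim_in J X j (act g j x)"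
  proof (rule colim_desc_colim_in)
    fix u x assume u: "u \<in> Arr J" "x \<in> FObj X (Dom J u)"
    then have "act g (Dom J u) x \<in> FObj X (Dom J u)"
      using assms category_J by (simp add: act_closed categoryD)
    from colim_in_arrow[OF category_J functor_X u(1) this]
    show "colim_in J X (Cod J u) (act g (Cod J u) (FArr X u x)) =
        colim_in J X (Dom J u) (act g (Dom J u) x)"
      using u assms by (simp add: act_natural)
  qed (use assms in auto)
  then show ?thesis by (simp add: colim_fun_def act_def)
qed

text \<open>The right-hand side of the canonical map consists of the classes fixed by
  \<open>G\<close>: those in which \<open>G\<close> moves a representative only within its
  class.\<close>

lemma set_lim_colim_fun:
  "set_lim (group_cat G) (colim_fun (group_cat G) J F) =
     {point (colim_in J X j x) | j x. j \<in> Obj J \<and> x \<in> FObj X j \<and>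
        (\<forall>g\<in>carrier G. ((j, act g j x), (j, x)) \<in> colim_rel J X)}" (is "?L = ?R")
proof -
  have mem: "point (colim_in J X j x) \<in> ?L \<longleftrightarrow>
      (\<forall>g\<in>carrier G. ((j, act g j x), (j, x)) \<in> colim_rel J X)"
    if jx: "j \<in> Obj J" "x \<in> FObj X j" for j x
  proof -
    have "point (colim_in J X j x) \<in> Pi\<^sub>E {\<one>} (FObj (colim_fun (group_cat G) J F))"
      using jx by (auto simp: point_def colim_fun_def set_colim_eq)
    then show ?thesis
      using jx by (simp add: set_lim_def colim_fun_arrow colim_in_eq_iff act_closed)
  qed
  show ?thesis
  proof (intro subset_antisym subsetI)
    fix s assume s: "s \<in> ?L"
    then have "s = point (s \<one>)" and "s \<one> \<in> set_colim J X"
      by (auto simp: set_lim_def colim_fun_def point_def fun_eq_iff PiE_def extensional_def)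
    then obtain j x where jx: "j \<in> Obj J" "x \<in> FObj X j" "s = point (colim_in J X j x)"
      unfolding set_colim_eq by auto
    with s mem show "s \<in> ?R" by blast
  qed (use mem in auto)
qed

lemma canonical_map_point:
  assumes "j \<in> Obj J" "x \<in> fixed_points j"
  shows "canonical_map (group_cat G) J F (colim_in J (lim_fun (group_cat G) J F) j (point x)) =
    point (colim_in J X j x)"
proof -
  have eq: "set_lim_map (group_cat G) (\<lambda>i. colim_in J (fix_left (group_cat G) F i) j) (point x) =
      point (colim_in J X j x)" for j x
    by (auto simp: set_lim_map_def point_def fun_eq_iff)
  show ?thesis
    unfolding canonical_map_def
    by (subst colim_desc_colim_in)
       (use assms category_J functor_X in
         \<open>auto simp: lim_fun_simps eq categoryD fixed_points_def colim_in_arrow\<close>)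
qed

text \<open>Completion of spans gives injectivity. The assumption \<open>descend\<close> supplies
  surjectivity: a representative of a fixed class becomes a fixed point after transport along some
  arrow, and transport does not change its class.\<close>

lemma bij_canonical_map:
  assumes spans: "completes_spans J"
    and descend: "\<And>j x. j \<in> Obj J \<Longrightarrow> x \<in> FObj X j \<Longrightarrow>
      (\<And>g. g \<in> carrier G \<Longrightarrow> equalized J X j (act g j x) j x) \<Longrightarrow>
      \<exists>u\<in>Arr J. Dom J u = j \<and> FArr X u x \<in> fixed_points (Cod J u)"
  shows "bij_betw (canonical_map (group_cat G) J F)
    (set_colim J (lim_fun (group_cat G) J F)) (set_lim (group_cat G) (colim_fun (group_cat G) J F))"
    (is "bij_betw ?\<kappa> ?A ?B")
proof -
  let ?L = "lim_fun (group_cat G) J F"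
  have A: "?A = {colim_in J ?L j (point x) | j x. j \<in> Obj J \<and> x \<in> fixed_points j}"
    (is "_ = ?A'")
  proof -
    have "colim_in J ?L j (point x) \<in> ?A" if "j \<in> Obj J" "x \<in> fixed_points j" for j x
      using that lim_fun_simps(1)[OF that(1)] unfolding set_colim_eq by blast
    moreover have "c \<in> ?A'" if "c \<in> ?A" for c
      using that lim_fun_simps(1) unfolding set_colim_eq by force
    ultimately show ?thesis by blast
  qed
  have XD: "x \<in> FObj X j" if "x \<in> fixed_points j" for x j
    using that by (simp add: fixed_points_def)
  have "inj_on ?\<kappa> ?A"
  proof (rule inj_onI)
    fix c d assume "c \<in> ?A" "d \<in> ?A" and eq: "?\<kappa> c = ?\<kappa> d"
    then obtain j x k y where c: "j \<in> Obj J" "x \<in> fixed_points j" "c = colim_in J ?L j (point x)"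
      and d: "k \<in> Obj J" "y \<in> fixed_points k" "d = colim_in J ?L k (point y)"
      unfolding A by blast
    from eq have "colim_in J X j x = colim_in J X k y"
      using c d by (simp add: canonical_map_point)
    then have "equalized J X j x k y"
      using c d category_J functor_X spans XD
      by (simp add: colim_in_eq_iff colim_rel_iff_equalized)
    \<comment> \<open>The same cospan serves, because \<open>lim_fun\<close> acts on points through
      \<open>X\<close>.\<close>
    then have "equalized J ?L j (point x) k (point y)"
      by (auto simp: equalized_def lim_fun_simps)
    then show "c = d"
      using c d category_J functor_lim_fun spans
      by (simp add: colim_in_eq_iff colim_rel_iff_equalized lim_fun_simps)
  qed
  moreover have "?\<kappa> ` ?A = ?B"
  proof (intro subset_antisym subsetI)
    fix s assume "s \<in> ?\<kappa> ` ?A"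
    then obtain j x where jx: "j \<in> Obj J" "x \<in> fixed_points j" "s = point (colim_in J X j x)"
      unfolding A by (auto simp: canonical_map_point)
    then have "((j, x), (j, x)) \<in> colim_rel J X"
      by (simp flip: colim_in_eq_iff add: XD)
    then have "\<forall>g\<in>carrier G. ((j, act g j x), (j, x)) \<in> colim_rel J X"
      using jx by (simp add: fixed_points_def)
    with jx XD show "s \<in> ?B"
      unfolding set_lim_colim_fun by blast
  next
    fix s assume "s \<in> ?B"
    then obtain j x where jx: "j \<in> Obj J" "x \<in> FObj X j" "s = point (colim_in J X j x)"
      and rel: "\<forall>g\<in>carrier G. ((j, act g j x), (j, x)) \<in> colim_rel J X"
      unfolding set_lim_colim_fun by blast
    have "equalized J X j (act g j x) j x" if "g \<in> carrier G" for g
      using rel that jx category_J functor_X spans by (simp add: colim_rel_iff_equalized act_closed)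
    from descend[OF jx(1,2) this] obtain u
      where u: "u \<in> Arr J" "Dom J u = j" "FArr X u x \<in> fixed_points (Cod J u)" by blast
    have "s = ?\<kappa> (colim_in J ?L (Cod J u) (point (FArr X u x)))"
      using canonical_map_point[OF _ u(3)] colim_in_arrow[OF category_J functor_X u(1), of x]
        categoryD(2)[OF category_J u(1)] u(2) jx(2,3) by simp
    moreover have "colim_in J ?L (Cod J u) (point (FArr X u x)) \<in> ?A"
      unfolding A using u(3) categoryD(2)[OF category_J u(1)] by blast
    ultimately show "s \<in> ?\<kappa> ` ?A" by blast
  qed
  ultimately show ?thesis by (simp add: bij_betw_def)
qed

end


lemma group_functor_intro:
  "group G \<Longrightarrow> category J \<Longrightarrow> set_functor (prod_cat (group_cat G) J) F \<Longrightarrow> group_functor G J F"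
  by (simp add: group_functor_def group_functor_axioms_def)


section \<open>Pseudo-filtered categories\<close>

text \<open>Take the connected component of \<open>a\<close>. As no arrow leaves it, cospans and
  coequalizing arrows of objects reachable from \<open>a\<close> can be sought in a filtered
  category.\<close>

lemma pseudo_filtered_component:
  assumes "pseudo_filtered C" "a \<in> Obj C"
  obtains A where "filtered (full_subcat C A)" "a \<in> A"
    "\<And>f. f \<in> Arr C \<Longrightarrow> Dom C f \<in> A \<Longrightarrow> Cod C f \<in> A"
proof
  define r where "r = (\<lambda>f. (Dom C f, Cod C f)) ` Arr C"
  define A where "A = generated_equiv (Obj C) r `` {a}"
  have C: "category C" using assms by (simp add: pseudo_filtered_def)
  have "A \<in> connected_components C"
    using assms(2) by (auto simp: connected_components_def A_def r_def intro: quotientI)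
  then show "filtered (full_subcat C A)"
    using assms by (simp add: pseudo_filtered_def)
  show "a \<in> A"
    unfolding A_def using equiv_class_self[OF equiv_generated_equiv] assms(2) by metis
  show "Cod C f \<in> A" if f: "f \<in> Arr C" "Dom C f \<in> A" for f
  proof -
    have "(Dom C f, Cod C f) \<in> generated_equiv (Obj C) r"
      by (rule generated_equivI) (use f C in \<open>auto simp: r_def categoryD\<close>)
    moreover have "(a, Dom C f) \<in> generated_equiv (Obj C) r"
      using f by (simp add: A_def)
    ultimately have "(a, Cod C f) \<in> generated_equiv (Obj C) r"
      using equiv_generated_equiv by (meson equiv_def transD)
    then show ?thesis by (simp add: A_def)
  qed
qed

lemma full_subcat_simps [simp]:
  "Obj (full_subcat C A) = A" "Comp (full_subcat C A) = Comp C"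
  "homset (full_subcat C A) a b = {f \<in> homset C a b. a \<in> A \<and> b \<in> A}"
  by (auto simp: full_subcat_def homset_def)

lemma pseudo_filtered_coequalize:
  assumes C: "pseudo_filtered C" and "f \<in> Arr C" "g \<in> Arr C" "Dom C f = Dom C g" "Cod C f = Cod C g"
  obtains h where "h \<in> Arr C" "Dom C h = Cod C f" "Comp C h f = Comp C h g"
proof -
  have "category C" using C by (simp add: pseudo_filtered_def)
  then have "Dom C f \<in> Obj C" using assms by (simp add: categoryD)
  then obtain A where A: "filtered (full_subcat C A)" "Dom C f \<in> A"
    "\<And>f. f \<in> Arr C \<Longrightarrow> Dom C f \<in> A \<Longrightarrow> Cod C f \<in> A"
    using pseudo_filtered_component[OF C] by blast
  have "Cod C f \<in> A" using A assms by blast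
  moreover have "f \<in> homset (full_subcat C A) (Dom C f) (Cod C f)"
    "g \<in> homset (full_subcat C A) (Dom C f) (Cod C f)"
    using A assms \<open>Cod C f \<in> A\<close> unfolding full_subcat_simps(3) by (auto simp: homset_def)
  ultimately obtain c h where "h \<in> homset (full_subcat C A) (Cod C f) c" "Comp C h f = Comp C h g"
    using A(1,2) unfolding filtered_def full_subcat_simps(1,2) by meson
  then show thesis using that unfolding full_subcat_simps(3) by (auto simp: homset_def)
qed

text \<open>Both codomains lie in the component of the common domain, so filteredness provides a
  cospan on them. The resulting square need not commute, but its two sides are parallel and can be
  coequalized.\<close>

lemma completes_spans_pseudo_filtered:
  assumes C: "pseudo_filtered C"
  shows "completes_spans C"
  unfolding completes_spans_def
proof (intro ballI impI)
  fix f g assume fg: "f \<in> Arr C" "g \<in> Arr C" "Dom C f = Dom C g"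
  have cat: "category C" using C by (simp add: pseudo_filtered_def)
  then have "Dom C f \<in> Obj C" using fg by (simp add: categoryD)
  then obtain A where A: "filtered (full_subcat C A)" "Dom C f \<in> A"
    "\<And>f. f \<in> Arr C \<Longrightarrow> Dom C f \<in> A \<Longrightarrow> Cod C f \<in> A"
    using pseudo_filtered_component[OF C] by blast
  have "Cod C f \<in> A" "Cod C g \<in> A" using A fg by auto
  then obtain c where "homset (full_subcat C A) (Cod C f) c \<noteq> {}"
    "homset (full_subcat C A) (Cod C g) c \<noteq> {}"
    using A(1) unfolding filtered_def full_subcat_simps(1) by meson
  then obtain h k where hk: "h \<in> Arr C" "k \<in> Arr C" "Dom C h = Cod C f" "Dom C k = Cod C g"
      "Cod C h = Cod C k"
    unfolding full_subcat_simps(3) by (auto simp: homset_def)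
  obtain e where e: "e \<in> Arr C" "Dom C e = Cod C h" "Comp C e (Comp C h f) = Comp C e (Comp C k g)"
    using pseudo_filtered_coequalize[OF C, of "Comp C h f" "Comp C k g"] hk fg cat
    by (metis categoryD(6-8))
  have "Comp C (Comp C e h) f = Comp C (Comp C e k) g"
    using e hk fg cat unfolding category_def by metis
  then show "\<exists>h\<in>Arr C. \<exists>k\<in>Arr C. Dom C h = Cod C f \<and> Dom C k = Cod C g \<and> Cod C h = Cod C k \<and>
        Comp C h f = Comp C k g"
    using e(1,2) hk cat
    by (intro bexI[of _ "Comp C e h"] bexI[of _ "Comp C e k"]) (simp_all add: categoryD)
qed

text \<open>Induction over finite sets \<open>S\<close> of group elements produces one arrow that
  identifies \<open>x\<close> with all its translates by \<open>S\<close>; finiteness of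
  \<open>G\<close> allows \<open>S\<close> to be all of it.\<close>

lemma (in group_functor) descend_pseudo_filtered:
  assumes fin: "finite (carrier G)" and J: "pseudo_filtered J"
    and jx: "j \<in> Obj J" "x \<in> FObj X j"
    and eq: "\<And>g. g \<in> carrier G \<Longrightarrow> equalized J X j (act g j x) j x"
  shows "\<exists>u\<in>Arr J. Dom J u = j \<and> FArr X u x \<in> fixed_points (Cod J u)"
proof -
  have "\<exists>u\<in>Arr J. Dom J u = j \<and> (\<forall>g\<in>S. FArr X u (act g j x) = FArr X u x)"
    if "finite S" "S \<subseteq> carrier G" for S
    using that
  proof (induction S)
    case empty
    show ?case using jx category_J by (intro bexI[of _ "Ident J j"]) (simp_all add: categoryD)
  next
    case (insert g S)
    then obtain u where u: "u \<in> Arr J" "Dom J u = j" "\<forall>g\<in>S. FArr X u (act g j x) = FArr X u x"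
      by auto
    from insert.prems eq[of g] obtain v w where vw: "v \<in> Arr J" "w \<in> Arr J" "Dom J v = j"
        "Dom J w = j" "Cod J v = Cod J w" "FArr X v (act g j x) = FArr X w x"
      by (auto simp: equalized_def)
    \<comment> \<open>Since \<open>act g j x\<close> and \<open>x\<close> lie over the same object
      \<open>j\<close>, the legs \<open>v\<close> and \<open>w\<close> are parallel. Once they are
      coequalized, the single arrow \<open>Comp J e v\<close> identifies the two elements.\<close>
    obtain e where e: "e \<in> Arr J" "Dom J e = Cod J v" "Comp J e v = Comp J e w"
      using pseudo_filtered_coequalize[OF J, of v w] vw by metis
    have ev: "Comp J e v \<in> Arr J" "Dom J (Comp J e v) = j"
      using e(1,2) vw(1,3) category_J by (simp_all add: categoryD)
    \<comment> \<open>Completing the span of the old and the new arrow yields one arrow that factors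
      through both, hence handles \<open>S\<close> and \<open>g\<close> at once.\<close>
    obtain p q where pq: "p \<in> Arr J" "q \<in> Arr J" "Dom J p = Cod J u" "Dom J q = Cod J (Comp J e v)"
        "Comp J p u = Comp J q (Comp J e v)"
      using completes_spans_pseudo_filtered[OF J] u ev unfolding completes_spans_def by metis
    have acts: "act h j x \<in> FObj X j" if "h \<in> insert g S" for h
      using that insert.prems jx act_closed by auto
    have comp: "FArr X (Comp J b a) y = FArr X b (FArr X a y)"
      if "a \<in> Arr J" "b \<in> Arr J" "Dom J b = Cod J a" "Dom J a = j" "y \<in> FObj X j" for a b y
      using set_functorD(3)[OF functor_X] that by metis
    have "FArr X (Comp J e v) (act g j x) = FArr X (Comp J e w) x"
      using comp e(1,2) vw acts jx(2) by simp
    then have "FArr X (Comp J p u) (act g j x) = FArr X (Comp J p u) x"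
      using pq(2,4,5) ev comp acts jx(2) e(3) by simp
    moreover have "FArr X (Comp J p u) (act h j x) = FArr X (Comp J p u) x" if "h \<in> S" for h
      using pq(1,3) u comp acts that jx(2) by simp
    moreover have "Comp J p u \<in> Arr J" "Dom J (Comp J p u) = j"
      using pq(1,3) u category_J by (simp_all add: categoryD)
    ultimately show ?case by blast
  qed
  from this[OF fin order_refl] obtain u
    where u: "u \<in> Arr J" "Dom J u = j" "\<forall>g\<in>carrier G. FArr X u (act g j x) = FArr X u x"
    by blast
  then have "act g (Cod J u) (FArr X u x) = FArr X u x" if "g \<in> carrier G" for g
    using act_natural[OF that u(1), of x] jx that by simp
  moreover have "FArr X u x \<in> FObj X (Cod J u)"
    using set_functorD(1)[OF functor_X u(1)] u(2) jx(2) by simp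
  ultimately show ?thesis using u unfolding fixed_points_def by blast
qed

lemma commutes_pseudo_filtered:
  assumes "group G" "finite (carrier G)" "pseudo_filtered J"
  shows "commutes small (group_cat G) J"
  unfolding commutes_def
proof (intro allI impI)
  fix F :: "('a \<times> 'a, 'a \<times> 'a, 'a) set_fun"
  assume F: "set_functor (prod_cat (group_cat G) J) F \<and> (\<forall>a\<in>Obj (prod_cat (group_cat G) J). small (FObj F a))"
  interpret group_functor G J F
    by (rule group_functor_intro) (use assms F in \<open>auto simp: pseudo_filtered_def\<close>)
  show "bij_betw (canonical_map (group_cat G) J F)
    (set_colim J (lim_fun (group_cat G) J F)) (set_lim (group_cat G) (colim_fun (group_cat G) J F))"
    using assms completes_spans_pseudo_filtered descend_pseudo_filtered
    by (intro bij_canonical_map) auto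
qed


section \<open>Groups as colimit shapes\<close>

text \<open>Goursat's argument. The subgroup \<open>N\<close> of all \<open>g\<close> with
  \<open>(g, \<one>)\<close> in \<open>S\<close> is normal in \<open>G\<close>, hence everything or
  trivial. If it is trivial, \<open>S\<close> is the graph of a homomorphism from a subgroup of
  \<open>H\<close> onto \<open>G\<close>, which exhibits \<open>G\<close> as a subquotient.\<close>

lemma simple_subdirect_product:
  assumes "simple_group G" "group H" and S: "subgroup S (G \<times>\<times> H)" and onto: "fst ` S = carrier G"
    and "\<not> is_subquotient G H" "g \<in> carrier G"
  shows "(g, \<one>\<^bsub>H\<^esub>) \<in> S"
proof -
  interpret G: simple_group G by fact
  interpret H: group H by fact
  have sub: "g \<in> carrier G" "h \<in> carrier H" if "(g, h) \<in> S" for g h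
    using subgroup.subset[OF S] that by auto
  have mult: "(a \<otimes>\<^bsub>G\<^esub> c, b \<otimes>\<^bsub>H\<^esub> d) \<in> S" if "(a, b) \<in> S" "(c, d) \<in> S" for a b c d
    using subgroup.m_closed[OF S that] by simp
  have inv: "(inv\<^bsub>G\<^esub> a, inv\<^bsub>H\<^esub> b) \<in> S" if "(a, b) \<in> S" for a b
    using subgroup.m_inv_closed[OF S that] sub[OF that] G.group_axioms H.group_axioms by simp
  have one: "(\<one>\<^bsub>G\<^esub>, \<one>\<^bsub>H\<^esub>) \<in> S"
    using subgroup.one_closed[OF S] by simp
  define N where "N = {g \<in> carrier G. (g, \<one>\<^bsub>H\<^esub>) \<in> S}"
  have "N \<lhd> G"
    unfolding G.normal_inv_iff
  proof (intro conjI ballI G.subgroupI)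
    show "N \<noteq> {}" using one by (auto simp: N_def)
    show "inv\<^bsub>G\<^esub> a \<in> N" if "a \<in> N" for a
      using inv[of a "\<one>\<^bsub>H\<^esub>"] that by (simp add: N_def)
    show "a \<otimes>\<^bsub>G\<^esub> b \<in> N" if "a \<in> N" "b \<in> N" for a b
      using mult[of a "\<one>\<^bsub>H\<^esub>" b "\<one>\<^bsub>H\<^esub>"] that by (simp add: N_def)
  next
    \<comment> \<open>By surjectivity \<open>x\<close> lifts to some \<open>(x, h)\<close> in
      \<open>S\<close>; conjugating \<open>(n, \<one>)\<close> by this lift leaves the second
      component neutral.\<close>
    fix x n assume x: "x \<in> carrier G" and n: "n \<in> N"
    then obtain h where h: "(x, h) \<in> S" using onto by force
    have "(x \<otimes>\<^bsub>G\<^esub> n \<otimes>\<^bsub>G\<^esub> inv\<^bsub>G\<^esub> x, h \<otimes>\<^bsub>H\<^esub> \<one>\<^bsub>H\<^esub> \<otimes>\<^bsub>H\<^esub> inv\<^bsub>H\<^esub> h) \<in> S"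
      using mult[OF mult[OF h] inv[OF h]] n by (simp add: N_def)
    then show "x \<otimes>\<^bsub>G\<^esub> n \<otimes>\<^bsub>G\<^esub> inv\<^bsub>G\<^esub> x \<in> N"
      using sub[OF h] x n by (simp add: N_def)
  qed (auto simp: N_def)
  then consider "N = carrier G" | "N = {\<one>\<^bsub>G\<^esub>}"
    using G.no_real_normal_subgroup by blast
  then show ?thesis
  proof cases
    case 1
    then show ?thesis using assms(6) by (auto simp: N_def)
  next
    case 2
    define K where "K = snd ` S"
    \<comment> \<open>The quotient of two elements of \<open>S\<close> with the same second
      component lies in \<open>N\<close>, so the second component determines the first.\<close>
    have uniq: "a = b" if "(a, h) \<in> S" "(b, h) \<in> S" for a b h
    proof -
      have "a \<otimes>\<^bsub>G\<^esub> inv\<^bsub>G\<^esub> b \<in> N"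
        using mult[OF that(1) inv[OF that(2)]] sub[OF that(1)] sub[OF that(2)] by (simp add: N_def)
      then have "a \<otimes>\<^bsub>G\<^esub> inv\<^bsub>G\<^esub> b = \<one>\<^bsub>G\<^esub>" using 2 by simp
      then show ?thesis
        using sub(1)[OF that(1)] sub(1)[OF that(2)] by (metis G.inv_equality G.inv_inv G.inv_closed)
    qed
    define \<rho> where "\<rho> h = (THE g. (g, h) \<in> S)" for h
    have \<rho>: "\<rho> h = g" if "(g, h) \<in> S" for g h
      unfolding \<rho>_def using that uniq by (intro the_equality) auto
    have K: "subgroup K H"
    proof (rule H.subgroupI)
      show "K \<noteq> {}" using one by (auto simp: K_def)
      show "inv\<^bsub>H\<^esub> a \<in> K" if "a \<in> K" for a
        using that inv unfolding K_def by force
      show "a \<otimes>\<^bsub>H\<^esub> b \<in> K" if "a \<in> K" "b \<in> K" for a b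
        using that mult unfolding K_def by force
    qed (use sub in \<open>auto simp: K_def\<close>)
    have "group_hom (H\<lparr>carrier := K\<rparr>) G \<rho>"
    proof (intro group_hom.intro group_hom_axioms.intro homI)
      show "\<rho> x \<in> carrier G" if "x \<in> carrier (H\<lparr>carrier := K\<rparr>)" for x
        using that sub \<rho> by (auto simp: K_def)
      show "\<rho> (x \<otimes>\<^bsub>H\<lparr>carrier := K\<rparr>\<^esub> y) = \<rho> x \<otimes>\<^bsub>G\<^esub> \<rho> y"
        if "x \<in> carrier (H\<lparr>carrier := K\<rparr>)" "y \<in> carrier (H\<lparr>carrier := K\<rparr>)" for x y
        using that mult \<rho> by (auto simp: K_def)
    qed (use K H.subgroup_imp_group G.group_axioms in auto)
    then interpret \<rho>: group_hom "H\<lparr>carrier := K\<rparr>" G \<rho> .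
    have "\<rho> ` K = carrier G"
    proof -
      have "\<rho> ` K = fst ` S"
        unfolding K_def image_image by (intro image_cong) (auto simp: \<rho>)
      then show ?thesis using onto by simp
    qed
    \<comment> \<open>First isomorphism theorem for \<open>\<rho>\<close>.\<close>
    then have "(H\<lparr>carrier := K\<rparr> Mod kernel (H\<lparr>carrier := K\<rparr>) G \<rho>) \<cong> G"
      using \<rho>.FactGroup_iso by simp
    then have "G \<cong> (H\<lparr>carrier := K\<rparr> Mod kernel (H\<lparr>carrier := K\<rparr>) G \<rho>)"
      using group.iso_sym normal.factorgroup_is_group \<rho>.normal_kernel by blast
    then have "is_subquotient G H"
      unfolding is_subquotient_def using K \<rho>.normal_kernel by blast
    then show ?thesis using assms(5) by blast
  qed
qed

text \<open>The subgroup \<open>S\<close> below is the stabilizer of \<open>x\<close> in the product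
  group. That the class of \<open>x\<close> is fixed by \<open>G\<close> says exactly that
  \<open>S\<close> projects onto \<open>G\<close>, so \<open>simple_subdirect_product\<close> makes
  \<open>x\<close> itself a fixed point.\<close>

lemma commutes_group_cat:
  assumes G: "simple_group G" and H: "group H" and no_sub: "\<not> is_subquotient G H"
  shows "commutes small (group_cat G) (group_cat H)"
  unfolding commutes_def
proof (intro allI impI)
  interpret simple_group G by fact
  interpret H: group H by fact
  let ?I = "group_cat G" and ?J = "group_cat H"
  fix F :: "('a \<times> 'a, 'a \<times> 'a, 'a) set_fun"
  assume F: "set_functor (prod_cat ?I ?J) F \<and> (\<forall>a\<in>Obj (prod_cat ?I ?J). small (FObj F a))"
  interpret group_functor G ?J F
    by (rule group_functor_intro) (use H F group_axioms category_group_cat in auto)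
  show "bij_betw (canonical_map ?I ?J F) (set_colim ?J (lim_fun ?I ?J F)) (set_lim ?I (colim_fun ?I ?J F))"
  proof (rule bij_canonical_map)
    fix j x assume j: "j \<in> Obj ?J" and x: "x \<in> FObj X j"
      and eq: "\<And>g. g \<in> carrier G \<Longrightarrow> equalized ?J X j (act g j x) j x"
    have j: "j = \<one>\<^bsub>H\<^esub>" using j by simp
    have comp: "FArr F (g, h) (FArr F (g', h') x) = FArr F (g \<otimes>\<^bsub>G\<^esub> g', h \<otimes>\<^bsub>H\<^esub> h') x"
      if "g \<in> carrier G" "g' \<in> carrier G" "h \<in> carrier H" "h' \<in> carrier H" for g g' h h'
      using F_comp[of g' g h' h x] that x j by simp
    have ident: "FArr F (\<one>\<^bsub>G\<^esub>, \<one>\<^bsub>H\<^esub>) x = x"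
      using F_ident[of j x] x j by simp
    define S where "S = {(g, h). g \<in> carrier G \<and> h \<in> carrier H \<and> FArr F (g, h) x = x}"
    have "subgroup S (G \<times>\<times> H)"
    proof (rule group.subgroupI[OF DirProd_group[OF group_axioms H]])
      show "S \<subseteq> carrier (G \<times>\<times> H)" by (auto simp: S_def)
      show "S \<noteq> {}" using ident by (auto simp: S_def)
      show "inv\<^bsub>G \<times>\<times> H\<^esub> p \<in> S" if "p \<in> S" for p
      proof -
        obtain g h where p: "p = (g, h)" "g \<in> carrier G" "h \<in> carrier H" "FArr F (g, h) x = x"
          using \<open>p \<in> S\<close> by (auto simp: S_def)
        have "FArr F (inv\<^bsub>G\<^esub> g, inv\<^bsub>H\<^esub> h) x = FArr F (inv\<^bsub>G\<^esub> g, inv\<^bsub>H\<^esub> h) (FArr F (g, h) x)"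
          by (simp add: p)
        also have "\<dots> = x" using comp p(2,3) ident by simp
        finally show ?thesis using p(1-3) group_axioms H by (simp add: S_def)
      qed
      show "p \<otimes>\<^bsub>G \<times>\<times> H\<^esub> q \<in> S" if "p \<in> S" "q \<in> S" for p q
        using that comp by (auto simp: S_def) (metis comp)
    qed
    moreover have "fst ` S = carrier G"
    proof (intro subset_antisym subsetI)
      fix g assume g: "g \<in> carrier G"
      \<comment> \<open>The element \<open>g\<close> moves \<open>x\<close> within its
        \<open>H\<close>-orbit. From \<open>u g x = v x\<close> it follows that \<open>g\<close>
        paired with the product of the inverse of \<open>v\<close> with \<open>u\<close> stabilizes
        \<open>x\<close>.\<close>
      then obtain u v where uv: "u \<in> carrier H" "v \<in> carrier H"
        "FArr F (\<one>\<^bsub>G\<^esub>, u) (FArr F (g, \<one>\<^bsub>H\<^esub>) x) = FArr F (\<one>\<^bsub>G\<^esub>, v) x"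
        using eq[OF g] by (auto simp: equalized_def FArr_X act_def)
      have "FArr F (g, inv\<^bsub>H\<^esub> v \<otimes>\<^bsub>H\<^esub> u) x = FArr F (\<one>\<^bsub>G\<^esub>, inv\<^bsub>H\<^esub> v) (FArr F (g, u) x)"
        using comp g uv(1,2) by simp
      also have "\<dots> = FArr F (\<one>\<^bsub>G\<^esub>, inv\<^bsub>H\<^esub> v) (FArr F (\<one>\<^bsub>G\<^esub>, v) x)"
        using comp[of "\<one>\<^bsub>G\<^esub>" g u "\<one>\<^bsub>H\<^esub>"] g uv by simp
      also have "\<dots> = x"
        using comp uv(1,2) ident by simp
      finally have "(g, inv\<^bsub>H\<^esub> v \<otimes>\<^bsub>H\<^esub> u) \<in> S"
        using g uv(1,2) by (simp add: S_def)
      then show "g \<in> fst ` S" by force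
    qed (auto simp: S_def)
    ultimately have "(g, \<one>\<^bsub>H\<^esub>) \<in> S" if "g \<in> carrier G" for g
      using simple_subdirect_product[OF G H _ _ no_sub that] by blast
    then have "x \<in> fixed_points j"
      using x j by (auto simp: fixed_points_def act_def S_def)
    \<comment> \<open>As \<open>x\<close> is already fixed, the identity arrow is a witness.\<close>
    then show "\<exists>u\<in>Arr ?J. Dom ?J u = j \<and> FArr X u x \<in> fixed_points (Cod ?J u)"
      using j ident by (intro bexI[of _ "\<one>\<^bsub>H\<^esub>"]) (auto simp: FArr_X)
  qed (use H completes_spans_group_cat in auto)
qed

text \<open>The first factor acts by left multiplication and the second by right multiplication; the
  inverse turns the latter into a covariant action.\<close>

definition two_sided :: "'a monoid \<Rightarrow> ('a \<times> 'a, 'a \<times> 'a, 'a) set_fun" where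
  "two_sided G = \<lparr>FObj = (\<lambda>_. carrier G), FArr = (\<lambda>(g, h) x. g \<otimes>\<^bsub>G\<^esub> x \<otimes>\<^bsub>G\<^esub> inv\<^bsub>G\<^esub> h)\<rparr>"

lemma set_functor_two_sided:
  assumes "group G"
  shows "set_functor (prod_cat (group_cat G) (group_cat G)) (two_sided G)"
proof -
  interpret group G by fact
  show ?thesis
    by (auto simp: set_functor_def prod_cat_def two_sided_def m_assoc inv_mult_group)
qed

text \<open>Left multiplication by a non-neutral element fixes nothing, so the colimit of the limits
  is empty. Right multiplication is transitive, so all elements share one class, which is fixed and
  gives a point of the limit of the colimits.\<close>

lemma not_commutes_self:
  assumes "group G" "carrier G \<noteq> {\<one>\<^bsub>G\<^esub>}" "small (carrier G)"
  shows "\<not> commutes small (group_cat G) (group_cat G)"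
proof
  interpret group G by fact
  let ?I = "group_cat G" and ?F = "two_sided G"
  interpret group_functor G ?I ?F
    by (intro group_functor_intro category_group_cat set_functor_two_sided assms)
  have FObj_X: "FObj X j = carrier G" for j
    by (simp add: fix_left_def two_sided_def)
  have FArr_F: "FArr ?F (g, h) x = g \<otimes>\<^bsub>G\<^esub> x \<otimes>\<^bsub>G\<^esub> inv\<^bsub>G\<^esub> h" for g h x
    by (simp add: two_sided_def)
  assume "commutes small ?I ?I"
  then have bij: "bij_betw (canonical_map ?I ?I ?F) (set_colim ?I (lim_fun ?I ?I ?F))
      (set_lim ?I (colim_fun ?I ?I ?F))"
    using set_functor_two_sided[OF assms(1)] assms(3) unfolding commutes_def
    by (simp add: two_sided_def)
  obtain g where g: "g \<in> carrier G" "g \<noteq> \<one>\<^bsub>G\<^esub>" using assms(2) one_closed by blast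
  have "act g j x \<noteq> x" if "x \<in> carrier G" for j x
    using g that by (simp add: act_def FArr_F)
  then have "fixed_points \<one>\<^bsub>G\<^esub> = {}"
    using g(1) by (auto simp: fixed_points_def FObj_X)
  then have "set_colim ?I (lim_fun ?I ?I ?F) = {}"
    by (simp add: set_colim_eq lim_fun_simps)
  moreover have "((\<one>\<^bsub>G\<^esub>, act h \<one>\<^bsub>G\<^esub> \<one>\<^bsub>G\<^esub>), (\<one>\<^bsub>G\<^esub>, \<one>\<^bsub>G\<^esub>)) \<in> colim_rel ?I X" if "h \<in> carrier G" for h
    \<comment> \<open>Here \<open>h\<close> is both the arrow and the element: its right action
      carries \<open>h\<close> to \<open>\<one>\<close>.\<close>
    using colim_relI[OF category_J functor_X, of h h] that
    by (simp add: FObj_X FArr_X act_def FArr_F)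
  then have "point (colim_in ?I X \<one>\<^bsub>G\<^esub> \<one>\<^bsub>G\<^esub>) \<in> set_lim ?I (colim_fun ?I ?I ?F)"
    unfolding set_lim_colim_fun using FObj_X
    by (intro CollectI exI[of _ "\<one>\<^bsub>G\<^esub>"] conjI) simp_all
  ultimately show False using bij by (auto simp: bij_betw_def)
qed


section \<open>Closed classes\<close>

text \<open>The two operations form a Galois connection, so applying them alternately three times is
  the same as applying the first once. Smallness of the members of \<open>\<I>\<close> places
  \<open>\<I>\<close> inside its double closure.\<close>

lemma closed_class_commuting_colims:
  assumes "\<I> \<subseteq> small_cats small"
  shows "closed_class small (commuting_colims small \<I>)"
  using assms unfolding closed_class_def commuting_colims_def commuting_lims_def by blast

lemma group_cat_small:
  assumes "smallness small" "group G" "small (carrier G)"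
  shows "group_cat G \<in> small_cats small"
  using assms category_group_cat by (auto simp: small_cats_def smallness_def)

text \<open>Lagrange's theorem twice: the index of \<open>L\<close> in \<open>K\<close> divides the
  order of \<open>K\<close>, which divides that of \<open>H\<close>. This excludes subquotients
  between groups of different prime orders.\<close>

lemma subquotient_order_dvd:
  assumes "group H" "finite (carrier H)" "is_subquotient G H"
  shows "order G dvd order H"
proof -
  interpret H: group H by fact
  obtain K L where K: "subgroup K H" and L: "L \<lhd> H\<lparr>carrier := K\<rparr>"
    and iso: "G \<cong> (H\<lparr>carrier := K\<rparr> Mod L)"
    using assms(3) by (auto simp: is_subquotient_def)
  interpret L: normal L "H\<lparr>carrier := K\<rparr>" by fact
  have "order G = card (rcosets\<^bsub>H\<lparr>carrier := K\<rparr>\<^esub> L)"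
    using iso_same_card[OF iso] by (simp add: order_def FactGroup_def)
  moreover have "card (rcosets\<^bsub>H\<lparr>carrier := K\<rparr>\<^esub> L) * card L = card K"
    using L.lagrange[OF L.subgroup_axioms] by (simp add: order_def)
  ultimately have "order G dvd card K"
    by (metis dvd_triv_left)
  also have "card K dvd order H"
    using H.lagrange[OF K] by (metis dvd_triv_right)
  finally show ?thesis .
qed

text \<open>The integers modulo \<open>n\<close> are transported into \<open>'u\<close> along an
  injection of the natural numbers, which exists because \<open>'u\<close> is infinite.\<close>

lemma exists_group_of_order:
  assumes "infinite (UNIV :: 'u set)" "n > 0"
  obtains G :: "'u monoid" where "group G" "finite (carrier G)" "order G = n"
proof -
  obtain f :: "nat \<Rightarrow> 'u" where f: "inj f"
    using infinite_countable_subset[OF assms(1)] by blast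
  let ?Z = "integer_mod_group n"
  have Z: "carrier ?Z = {0..<int n}"
    using assms(2) by (simp add: carrier_integer_mod_group)
  \<comment> \<open>\<open>nat\<close> is injective on the nonnegative integers, and the carrier
    consists of such.\<close>
  have inj: "inj_on (f \<circ> nat) (carrier ?Z)"
    unfolding Z by (intro comp_inj_on inj_on_subset[OF f]) (auto simp: inj_on_def eq_nat_nat_iff)
  show thesis
  proof
    show "group (image_group (f \<circ> nat) ?Z)"
      using group.inj_imp_image_group_is_group[OF group_integer_mod_group inj] .
    show "finite (carrier (image_group (f \<circ> nat) ?Z))"
      by (simp add: image_group_carrier Z)
    show "order (image_group (f \<circ> nat) ?Z) = n"
      unfolding order_def image_group_carrier card_image[OF inj] by (simp add: Z)
  qed
qed

theorem mainTheorem5: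
  fixes small :: "'u set \<Rightarrow> bool"
  assumes "smallness small"
  shows "infinite {\<J>. closed_class small \<J> \<and>
                      {J \<in> small_cats small. pseudo_filtered J} \<subseteq> \<J> \<and>
                      \<J> \<subseteq> small_cats small} \<and>
    (\<forall>G :: 'u monoid. simple_group G \<and> finite (carrier G) \<longrightarrow>
       closed_class small (commuting_colims small {group_cat G}) \<and>
       (\<forall>H :: 'u monoid. group H \<and> small (carrier H) \<and> \<not> is_subquotient G H \<longrightarrow>
          group_cat H \<in> commuting_colims small {group_cat G}) \<and>
       group_cat G \<notin> commuting_colims small {group_cat G})"
proof
  let ?c = "\<lambda>G :: 'u monoid. commuting_colims small {group_cat G}"
  have inf: "infinite (UNIV :: 'u set)" and small_fin: "finite A \<Longrightarrow> small A" for A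
    using assms by (auto simp: smallness_def)
  have closed: "closed_class small (?c G)" if "group G" "finite (carrier G)" for G
    using that assms small_fin by (intro closed_class_commuting_colims) (simp add: group_cat_small)
  have mem: "group_cat H \<in> ?c G"
    if "simple_group G" "group H" "small (carrier H)" "\<not> is_subquotient G H" for G H
    using that assms by (simp add: commuting_colims_def group_cat_small commutes_group_cat)
  have not_mem: "group_cat G \<notin> ?c G" if "simple_group G" "finite (carrier G)" for G
    using not_commutes_self[of G small] that small_fin simple_group.simple_not_triv
      simple_group.axioms(1)
    by (auto simp: commuting_colims_def)
  show "\<forall>G :: 'u monoid. simple_group G \<and> finite (carrier G) \<longrightarrow>
       closed_class small (?c G) \<and>
       (\<forall>H :: 'u monoid. group H \<and> small (carrier H) \<and> \<not> is_subquotient G H \<longrightarrow> group_cat H \<in> ?c G) \<and>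
       group_cat G \<notin> ?c G"
    using closed mem not_mem simple_group.axioms(1) by blast
  have "\<exists>G :: 'u monoid. n > 0 \<longrightarrow> group G \<and> finite (carrier G) \<and> order G = n" for n
    using exists_group_of_order[OF inf, of n] by blast
  then have "\<exists>Z :: nat \<Rightarrow> 'u monoid. \<forall>n. n > 0 \<longrightarrow>
      group (Z n) \<and> finite (carrier (Z n)) \<and> order (Z n) = n"
    by (intro choice) blast
  then obtain Z :: "nat \<Rightarrow> 'u monoid"
    where Z: "\<And>n. n > 0 \<Longrightarrow> group (Z n) \<and> finite (carrier (Z n)) \<and> order (Z n) = n"
    by blast
  have simple: "simple_group (Z p)" if "prime p" for p
    using Z[of p] that by (simp add: group.prime_order_simple prime_gt_0_nat)
  \<comment> \<open>For distinct primes \<open>p\<close> and \<open>q\<close>, the group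
    \<open>Z q\<close> separates the two classes: it belongs to the class of \<open>Z p\<close> by
    divisibility, but not to its own.\<close>
  have "inj_on (\<lambda>p. ?c (Z p)) {p. prime p}"
  proof (rule inj_onI, rule ccontr)
    fix p q :: nat assume pq: "p \<in> {p. prime p}" "q \<in> {p. prime p}" "?c (Z p) = ?c (Z q)" "p \<noteq> q"
    then have Zpq: "group (Z q)" "finite (carrier (Z q))" "order (Z p) = p" "order (Z q) = q"
      using Z prime_gt_0_nat by auto
    have "\<not> p dvd q" using pq primes_dvd_imp_eq by blast
    then have "\<not> is_subquotient (Z p) (Z q)"
      using subquotient_order_dvd[OF Zpq(1,2), of "Z p"] Zpq(3,4) by auto
    then have "group_cat (Z q) \<in> ?c (Z p)"
      using mem simple pq(1) Zpq small_fin by auto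
    then show False using not_mem[of "Z q"] simple pq Zpq by auto
  qed
  then have "infinite ((\<lambda>p. ?c (Z p)) ` {p. prime p})"
    using primes_infinite by (simp add: finite_image_iff)
  moreover have "(\<lambda>p. ?c (Z p)) ` {p. prime p} \<subseteq> {\<J>. closed_class small \<J> \<and>
      {J \<in> small_cats small. pseudo_filtered J} \<subseteq> \<J> \<and> \<J> \<subseteq> small_cats small}"
  proof (intro image_subsetI CollectI conjI)
    fix p :: nat assume "p \<in> {p. prime p}"
    then have "group (Z p)" "finite (carrier (Z p))"
      using Z[of p] prime_gt_0_nat by auto
    then show "closed_class small (?c (Z p))" by (rule closed)
    show "{J \<in> small_cats small. pseudo_filtered J} \<subseteq> ?c (Z p)"
      using \<open>group (Z p)\<close> \<open>finite (carrier (Z p))\<close>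
      by (auto simp: commuting_colims_def commutes_pseudo_filtered)
    show "?c (Z p) \<subseteq> small_cats small"
      by (auto simp: commuting_colims_def)
  qed
  ultimately show "infinite {\<J>. closed_class small \<J> \<and>
      {J \<in> small_cats small. pseudo_filtered J} \<subseteq> \<J> \<and> \<J> \<subseteq> small_cats small}"
    using infinite_super by blast
qed

end
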